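(* Let $G$ be a graph that is not a clique, and let $\mathcal{C}$ be a circle representation for $G$. Let $\mathcal{C}_{\emptyset}$ be the set of peripheral chords of $\mathcal{C}$ and let $G_{\mathcal{C}_{\emptyset}}$ be the intersection graph of $\mathcal{C}_{\emptyset}$. Then $\psi_r(\mathcal{C}) = \kappa(G_{\mathcal{C}_{\emptyset}})$.
   Context: All graphs are finite, simple and undirected. A circle representation of a graph $G$ is a set of chords of a circle, one per vertex, with all chord endpoints distinct, such that two vertices are adjacent if and only if their chords intersect. The two endpoints of a chord split the circle into two open arcs (the arcs of the chord). An open arc of the circle is empty if it does not contain both endpoints of any chord of the representation. A chord is peripheral if at least one of its two arcs is empty. Corners are points of the circle distinct from all chord endpoints; a set of corners satisfies a chord if each of the two arcs of the chord contains a corner. $\psi_r(\mathcal{C})$, the polygon number of the circle representation $\mathcal{C}$, is the minimum number of corners that must be added to $\mathcal{C}$ so that every chord of $\mathcal{C}$ is satisfied. $\kappa(H)$ denotes the minimum number of cliques needed to cover (partition) the vertex set of a graph $H$. *)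

theory Defs
  imports
    "HOL-Analysis.Analysis"
    "HOL-Library.Disjoint_Sets"
    "Graph_Theory.Pair_Digraph"
begin

text \<open>
  Finite simple undirected graphs are the graphs of the locale \<^locale>\<open>pair_graph\<close>: finitely many
  vertices, and an irreflexive, symmetric arc relation on them.
\<close>

definition clique :: "'a pair_pre_digraph \<Rightarrow> 'a set \<Rightarrow> bool" where
  "clique G K \<longleftrightarrow> K \<subseteq> pverts G \<and> (\<forall>u\<in>K. \<forall>v\<in>K. u \<noteq> v \<longrightarrow> (u, v) \<in> parcs G)"

definition clique_cover_number :: "'a pair_pre_digraph \<Rightarrow> nat" where
  "clique_cover_number G =
     (LEAST k. \<exists>P. partition_on (pverts G) P \<and> finite P \<and> card P = k \<and> (\<forall>K\<in>P. clique G K))"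

text \<open>
  The plane is \<^typ>\<open>complex\<close>. A chord is encoded by the set \<open>{p, q}\<close> of its two endpoints, so that
  the chord as a point set is the segment \<open>convex hull {p, q}\<close>.
\<close>

type_synonym chord = "complex set"

definition is_circle :: "complex set \<Rightarrow> bool" where
  "is_circle \<Gamma> \<longleftrightarrow> (\<exists>z r. r > 0 \<and> \<Gamma> = sphere z r)"

definition is_chord :: "complex set \<Rightarrow> chord \<Rightarrow> bool" where
  "is_chord \<Gamma> c \<longleftrightarrow> c \<subseteq> \<Gamma> \<and> card c = 2"

definition chords_intersect :: "chord \<Rightarrow> chord \<Rightarrow> bool" where
  "chords_intersect c d \<longleftrightarrow> convex hull c \<inter> convex hull d \<noteq> {}"

definition intersection_graph :: "chord set \<Rightarrow> chord pair_pre_digraph" where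
  "intersection_graph \<C> =
     \<lparr>pverts = \<C>, parcs = {(c, d) \<in> \<C> \<times> \<C>. c \<noteq> d \<and> chords_intersect c d}\<rparr>"

text \<open>
  Pairwise disjointness of the endpoint sets says that all chord endpoints are distinct. The
  bijection \<open>f\<close> assigns to each vertex its chord.
\<close>

definition circle_representation ::
  "complex set \<Rightarrow> chord set \<Rightarrow> 'a pair_pre_digraph \<Rightarrow> bool" where
  "circle_representation \<Gamma> \<C> G \<longleftrightarrow>
     is_circle \<Gamma> \<and> (\<forall>c\<in>\<C>. is_chord \<Gamma> c) \<and> disjoint \<C> \<and>
     (\<exists>f. bij_betw f (pverts G) \<C> \<and>
        (\<forall>u\<in>pverts G. \<forall>v\<in>pverts G. u \<noteq> v \<longrightarrow>
           ((u, v) \<in> parcs G \<longleftrightarrow> chords_intersect (f u) (f v))))"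

text \<open>The open arcs of a chord are the connected components of the circle minus its endpoints.\<close>

definition arcs_of :: "complex set \<Rightarrow> chord \<Rightarrow> complex set set" where
  "arcs_of \<Gamma> c = components (\<Gamma> - c)"

definition empty_arc :: "chord set \<Rightarrow> complex set \<Rightarrow> bool" where
  "empty_arc \<C> A \<longleftrightarrow> (\<forall>c\<in>\<C>. \<not> c \<subseteq> A)"

definition peripheral_chords :: "complex set \<Rightarrow> chord set \<Rightarrow> chord set" where
  "peripheral_chords \<Gamma> \<C> = {c \<in> \<C>. \<exists>A\<in>arcs_of \<Gamma> c. empty_arc \<C> A}"

definition satisfies :: "complex set \<Rightarrow> complex set \<Rightarrow> chord \<Rightarrow> bool" where
  "satisfies \<Gamma> S c \<longleftrightarrow> (\<forall>A\<in>arcs_of \<Gamma> c. A \<inter> S \<noteq> {})"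

text \<open>Corners are points of the circle that are not endpoints of chords, hence \<open>S \<subseteq> \<Gamma> - \<Union>\<C>\<close>.\<close>

definition polygon_number :: "complex set \<Rightarrow> chord set \<Rightarrow> nat" where
  "polygon_number \<Gamma> \<C> =
     (LEAST k. \<exists>S. S \<subseteq> \<Gamma> - \<Union>\<C> \<and> finite S \<and> card S = k \<and> (\<forall>c\<in>\<C>. satisfies \<Gamma> S c))"

end

theory Submission
  imports Defs
begin

text \<open>
  Every arc of a chord contains an empty arc, so the corners have to hit exactly the empty arcs, and
  two distinct peripheral chords cross iff their empty arcs meet. Hence the chords hit by
  one corner form a clique. For the converse, lift the empty arcs to intervals of the real line;
  none contains another. Starting from an interval \<open>x\<close>, jump repeatedly to the first interval that
  begins after the current one ends. If some \<open>m\<close> jumps complete a full turn, \<open>m\<close> corners suffice.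
  Otherwise the winding number of an orbit of \<open>T\<close> jumps falls short of \<open>T/m\<close> by an amount that
  grows linearly in \<open>T\<close>. As \<open>m \<ge> 2\<close>, consecutive members
  are never in a common clique, which makes the number of orbit members in a clique at most about
  the winding number, so that \<open>m\<close> cliques cannot cover the orbit.
\<close>

subsection \<open>Greedy hitting sets for periodic intervals\<close>

lemma shift_into_period:
  fixes L :: real
  assumes L: "0 < L"
  shows "\<exists>k::int. a \<le> x + of_int k * L \<and> x + of_int k * L < a + L"
proof -
  have "of_int \<lfloor>(x - a) / L\<rfloor> * L \<le> x - a" "x - a < (of_int \<lfloor>(x - a) / L\<rfloor> + 1) * L"
    using L by (rule floor_divide_lower, rule floor_divide_upper)
  thus ?thesis by (intro exI[of _ "- \<lfloor>(x - a) / L\<rfloor>"]) (auto simp: algebra_simps)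
qed

text \<open>Arcs of a circle of length \<open>L\<close>, seen on the universal cover:
  \<open>X\<close> holds the left ends of all lifts and \<open>E\<close> gives the right ends.
  \<open>E_mono\<close> encodes that no arc contains another.\<close>

locale periodic_intervals =
  fixes L :: real and X :: "real set" and E :: "real \<Rightarrow> real"
  assumes L_pos: "0 < L"
    and X_nonempty: "X \<noteq> {}"
    and finite_X: "finite (X \<inter> {0..<L})"
    and X_shift: "\<And>x k. x \<in> X \<Longrightarrow> x + of_int k * L \<in> X"
    and E_shift: "\<And>x k. x \<in> X \<Longrightarrow> E (x + of_int k * L) = E x + of_int k * L"
    and less_E: "\<And>x. x \<in> X \<Longrightarrow> x < E x"
    and E_mono: "\<And>x y. x \<in> X \<Longrightarrow> y \<in> X \<Longrightarrow> x < y \<Longrightarrow> E x < E y"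
begin

lemma finite_X_interval: "finite (X \<inter> {a..b})"
proof -
  define N where "N = {\<lfloor>a / L\<rfloor>..\<lfloor>b / L\<rfloor>}"
  have "X \<inter> {a..b} \<subseteq> (\<Union>k\<in>N. (\<lambda>x. x + of_int k * L) ` (X \<inter> {0..<L}))"
  proof
    fix x assume x: "x \<in> X \<inter> {a..b}"
    define k where "k = \<lfloor>x / L\<rfloor>"
    have kN: "k \<in> N" using x L_pos by (auto simp: N_def k_def intro!: floor_mono divide_right_mono)
    have "of_int k \<le> x / L" "x / L < of_int k + 1" unfolding k_def by linarith+
    hence "x + of_int (-k) * L \<in> {0..<L}" using L_pos by (simp add: field_simps)
    moreover have "x + of_int (-k) * L \<in> X" using x X_shift by blast
    ultimately show "x \<in> (\<Union>k\<in>N. (\<lambda>x. x + of_int k * L) ` (X \<inter> {0..<L}))"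
      using kN by (intro UN_I[of k] image_eqI[of _ _ "x + of_int (-k) * L"]) auto
  qed
  moreover have "finite (\<Union>k\<in>N. (\<lambda>x. x + of_int k * L) ` (X \<inter> {0..<L}))"
    using finite_X by (auto simp: N_def)
  ultimately show ?thesis by (rule finite_subset)
qed

text \<open>Periodicity makes \<open>X\<close> unbounded above, so some start \<open>b\<close> lies
  beyond \<open>c\<close>, and the minimum can be taken over a finite window.\<close>

lemma ex_least_start: "\<exists>y\<in>X. c \<le> y \<and> (\<forall>y'\<in>X. c \<le> y' \<longrightarrow> y \<le> y')"
proof -
  obtain x where x: "x \<in> X" using X_nonempty by auto
  obtain k where k: "c \<le> x + of_int k * L" using shift_into_period[OF L_pos] by blast
  define b where "b = x + of_int k * L"
  have b: "b \<in> X \<inter> {c..b}" using k x X_shift by (auto simp: b_def)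
  define y where "y = Min (X \<inter> {c..b})"
  have fin: "finite (X \<inter> {c..b})" by (rule finite_X_interval)
  have y: "y \<in> X \<inter> {c..b}" unfolding y_def using Min_in[OF fin] b by blast
  have "y \<le> y'" if "y' \<in> X" "c \<le> y'" for y'
  proof (cases "y' \<le> b")
    case True thus ?thesis unfolding y_def using that fin by (intro Min_le) auto
  next
    case False thus ?thesis using y by auto
  qed
  thus ?thesis using y by auto
qed

section \<open>The greedy jump map and its orbits\<close>

text \<open>The bound \<open>E x \<le> y\<close> is not strict because the intervals count as open:
  two that only touch share no point.\<close>

definition greedy :: "real \<Rightarrow> real" where
  "greedy x = (SOME y. y \<in> X \<and> E x \<le> y \<and> (\<forall>y'\<in>X. E x \<le> y' \<longrightarrow> y \<le> y'))"

lemma greedy_props: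
  shows greedy_in: "greedy x \<in> X" and E_le_greedy: "E x \<le> greedy x"
    and greedy_le: "y \<in> X \<Longrightarrow> E x \<le> y \<Longrightarrow> greedy x \<le> y"
proof -
  have "\<exists>y. y \<in> X \<and> E x \<le> y \<and> (\<forall>y'\<in>X. E x \<le> y' \<longrightarrow> y \<le> y')"
    using ex_least_start[of "E x"] by auto
  from someI_ex[OF this] show "greedy x \<in> X" "E x \<le> greedy x"
    "y \<in> X \<Longrightarrow> E x \<le> y \<Longrightarrow> greedy x \<le> y" by (auto simp: greedy_def)
qed

lemma less_greedy: "x \<in> X \<Longrightarrow> x < greedy x"
  using less_E E_le_greedy by (meson less_le_trans)

lemma greedy_mono:
  assumes "x \<in> X" "y \<in> X" "x \<le> y" shows "greedy x \<le> greedy y"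
proof (rule greedy_le)
  show "E x \<le> greedy y" using E_mono[of x y] E_le_greedy[of y] assms by (cases "x = y") auto
qed (rule greedy_in)

text \<open>Minimality gives both inequalities, with shifts by \<open>k\<close> and
  \<open>-k\<close>. Together with \<open>greedy_mono\<close> this makes \<open>greedy\<close> the
  lift of a monotone circle map of degree one, so that orbits have a winding number.\<close>

lemma greedy_shift:
  assumes x: "x \<in> X" shows "greedy (x + of_int k * L) = greedy x + of_int k * L"
proof (rule antisym)
  show "greedy (x + of_int k * L) \<le> greedy x + of_int k * L"
    using greedy_in E_le_greedy[of x] x by (intro greedy_le X_shift) (auto simp: E_shift)
  have "greedy x \<le> greedy (x + of_int k * L) + of_int (-k) * L"
    using greedy_in E_le_greedy[of "x + of_int k * L"] x
    by (intro greedy_le X_shift) (auto simp: E_shift)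
  thus "greedy x + of_int k * L \<le> greedy (x + of_int k * L)" by simp
qed

lemma greedy_iter_in: "x \<in> X \<Longrightarrow> (greedy ^^ n) x \<in> X"
  by (cases n) (auto simp: greedy_in)

lemma greedy_iter_shift:
  "x \<in> X \<Longrightarrow> (greedy ^^ n) (x + of_int k * L) = (greedy ^^ n) x + of_int k * L"
  by (induction n) (auto simp: greedy_shift greedy_iter_in)

lemma greedy_iter_strict: "x \<in> X \<Longrightarrow> i < j \<Longrightarrow> (greedy ^^ i) x < (greedy ^^ j) x"
proof (induction j)
  case (Suc j)
  have "(greedy ^^ j) x < (greedy ^^ Suc j) x" using Suc.prems less_greedy greedy_iter_in by simp
  thus ?case using Suc by (cases "i = j") (auto intro: less_trans)
qed simp

lemma greedy_iter_le: "x \<in> X \<Longrightarrow> i \<le> j \<Longrightarrow> (greedy ^^ i) x \<le> (greedy ^^ j) x"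
  using greedy_iter_strict[of x i j] by (cases "i = j") auto

text \<open>Each of the first \<open>m\<close> orbit members receives one point just before its
  right end. An interval that starts between this member and the next one contains that point, as it
  ends no earlier than the member. \<open>Y\<close> collects the points to avoid.\<close>

lemma greedy_hits:
  assumes x: "x \<in> X" and wrap: "x + L \<le> (greedy ^^ m) x"
    and Y: "\<And>a b. finite (Y \<inter> {a..b})"
  shows "\<exists>P. finite P \<and> card P \<le> m \<and> P \<inter> Y = {} \<and>
           (\<forall>y\<in>X. \<exists>p\<in>P. \<exists>k::int. y + of_int k * L < p \<and> p < E y + of_int k * L)"
proof -
  have "\<exists>p. p < c \<and> p \<notin> Y \<and> (\<forall>y\<in>X. y < c \<longrightarrow> y < p)" for c
  proof -
    \<comment> \<open>The unit window below \<open>c\<close> keeps \<open>F\<close> finite, and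
      \<open>c - 1\<close> is a default if nothing else lies there. No element of \<open>X\<close>
      or \<open>Y\<close> lies strictly between \<open>Max F\<close> and \<open>c\<close>, so their
      midpoint serves.\<close>
    define F where "F = insert (c - 1) ((X \<union> Y) \<inter> {c - 1..c} - {c})"
    have "finite ((X \<inter> {c - 1..c}) \<union> (Y \<inter> {c - 1..c}))" using Y finite_X_interval by blast
    moreover have "F \<subseteq> insert (c - 1) ((X \<inter> {c - 1..c}) \<union> (Y \<inter> {c - 1..c}))" by (auto simp: F_def)
    ultimately have fin: "finite F" by (meson finite_insert finite_subset)
    define q where "q = Max F"
    have "q \<in> F" unfolding q_def using fin Max_in[OF fin] by (auto simp: F_def)
    hence qc: "q < c" "c - 1 \<le> q" by (auto simp: F_def)
    have le: "y \<le> q" if "y \<in> X \<union> Y" "y < c" for y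
    proof (cases "c - 1 \<le> y")
      case True
      thus ?thesis unfolding q_def using that fin by (intro Max_ge) (auto simp: F_def)
    qed (use qc in auto)
    show ?thesis
    proof (intro exI[of _ "(q + c) / 2"] conjI ballI impI notI)
      show "(q + c) / 2 < c" using qc by simp
      show False if "(q + c) / 2 \<in> Y" using le[of "(q + c) / 2"] qc that by auto
      show "y < (q + c) / 2" if "y \<in> X" "y < c" for y using le[of y] qc that by auto
    qed
  qed
  then obtain pre where pre: "\<And>c. pre c < c" "\<And>c. pre c \<notin> Y"
      "\<And>c y. y \<in> X \<Longrightarrow> y < c \<Longrightarrow> y < pre c" by metis
  define P where "P = (\<lambda>j. pre (E ((greedy ^^ j) x))) ` {..<m}"
  show ?thesis
  proof (intro exI[of _ P] conjI ballI)
    show "finite P" "card P \<le> m" using card_image_le[of "{..<m}"] by (force simp: P_def)+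
    show "P \<inter> Y = {}" using pre by (auto simp: P_def)
    fix y assume y: "y \<in> X"
    obtain k where k: "x \<le> y + of_int k * L" "y + of_int k * L < x + L"
      using shift_into_period[OF L_pos] by blast
    define y' where "y' = y + of_int k * L"
    have y': "y' \<in> X" using y X_shift by (auto simp: y'_def)
    have "\<exists>j<n. (greedy ^^ j) x \<le> y' \<and> y' < (greedy ^^ Suc j) x" if "y' < (greedy ^^ n) x" for n
      using that
    proof (induction n)
      case 0 thus ?case using k by (auto simp: y'_def)
    next
      case (Suc n) thus ?case by (metis less_Suc_eq not_le)
    qed
    moreover have "y' < (greedy ^^ m) x" using wrap k by (auto simp: y'_def)
    ultimately obtain j where j: "j < m" "(greedy ^^ j) x \<le> y'" "y' < (greedy ^^ Suc j) x" by blast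
    define u where "u = (greedy ^^ j) x"
    have u: "u \<in> X" using greedy_iter_in x by (auto simp: u_def)
    \<comment> \<open>Minimality of the jump: a start at or beyond \<open>E u\<close> would be at
      least \<open>greedy u\<close>.\<close>
    have "y' < E u" using greedy_le[of y' u] j y' by (force simp: u_def)
    hence "y' < pre (E u)" using pre y' by blast
    moreover have "E u \<le> E y'" using E_mono[of u y'] u y' j by (cases "u = y'") (auto simp: u_def)
    moreover have "E y' = E y + of_int k * L" using y by (simp add: y'_def E_shift)
    ultimately show "\<exists>p\<in>P. \<exists>k::int. y + of_int k * L < p \<and> p < E y + of_int k * L"
      using j pre(1)[of "E u"] unfolding P_def u_def y'_def
      by (intro bexI[of _ "pre (E ((greedy ^^ j) x))"] exI[of _ k]) auto
  qed
qed

text \<open>The colouring \<open>q\<close> abstracts a clique cover: arcs of equal colour overlap up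
  to translation. If \<open>m\<close> jumps always fell short of a turn, a long orbit would wind too
  slowly for \<open>m\<close> colour classes, each holding at most about one member per
  turn.\<close>

lemma greedy_wraps:
  assumes fin: "finite Q" and card: "card Q = m" "2 \<le> m"
    and col: "\<And>x. x \<in> X \<Longrightarrow> q x \<in> Q"
    and meet: "\<And>x y. x \<in> X \<Longrightarrow> y \<in> X \<Longrightarrow> q x = q y \<Longrightarrow>
                 \<exists>k::int. x + of_int k * L < E y \<and> y < E x + of_int k * L"
  shows "\<exists>x\<in>X. x + L \<le> (greedy ^^ m) x"
proof (rule ccontr)
  assume "\<not> ?thesis"
  hence short: "\<And>x. x \<in> X \<Longrightarrow> (greedy ^^ m) x < x + L" by force
  have "\<exists>d>0. \<forall>x\<in>X. (greedy ^^ m) x \<le> x + L - d"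
  proof -
    \<comment> \<open>Finitely many starts modulo \<open>L\<close> make the shortfall uniform; the
      element 1 makes \<open>D\<close> visibly nonempty.\<close>
    define D where "D = insert 1 ((\<lambda>x. x + L - (greedy ^^ m) x) ` (X \<inter> {0..<L}))"
    have finD: "finite D" "D \<noteq> {}" using finite_X by (auto simp: D_def)
    have "Min D \<in> D" using finD by (rule Min_in)
    hence "Min D > 0" using short by (auto simp: D_def)
    moreover have "(greedy ^^ m) x \<le> x + L - Min D" if x: "x \<in> X" for x
    proof -
      obtain k where k: "0 \<le> x + of_int k * L" "x + of_int k * L < 0 + L"
        using shift_into_period[OF L_pos] by blast
      have "x + of_int k * L + L - (greedy ^^ m) (x + of_int k * L) \<in> D"
        using k x X_shift by (auto simp: D_def)
      hence "Min D \<le> x + of_int k * L + L - (greedy ^^ m) (x + of_int k * L)"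
        using finD by (intro Min_le) auto
      thus ?thesis using greedy_iter_shift[OF x] by simp
    qed
    ultimately show ?thesis by blast
  qed
  then obtain d where d: "d > 0" "\<And>x. x \<in> X \<Longrightarrow> (greedy ^^ m) x \<le> x + L - d" by blast
  obtain x0 where x0: "x0 \<in> X" using X_nonempty by auto
  define s where "s j = (greedy ^^ j) x0" for j
  have sX: "s j \<in> X" for j using greedy_iter_in x0 by (auto simp: s_def)
  have s_Suc: "s (Suc j) = greedy (s j)" for j by (simp add: s_def)
  have s_mono: "s i \<le> s j" if "i \<le> j" for i j
    using greedy_iter_le[OF x0 that] by (simp add: s_def)
  have s_add: "s (i + m) \<le> s i + L - d" for i
    using d(2)[OF sX[of i]] by (simp add: s_def funpow_add add.commute[of i])
  have s_mult: "s (m * M) \<le> s 0 + of_nat M * (L - d)" for M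
  proof (induction M)
    case (Suc M) thus ?case using s_add[of "m * M"] by (simp add: algebra_simps)
  qed simp
  \<comment> \<open>Here \<open>2 \<le> m\<close> enters: two jumps reach no further than
    \<open>m\<close> jumps.\<close>
  have short2: "s (Suc (Suc j)) < s j + L" for j
  proof -
    have "s (Suc (Suc j)) \<le> s (j + m)" using card by (intro s_mono) auto
    also have "\<dots> < s j + L" using s_add[of j] d by simp
    finally show ?thesis .
  qed
  \<comment> \<open>An overlap of consecutive members would need a translation strictly between zero
    and one period.\<close>
  have consec: "q (s j) \<noteq> q (s (Suc j))" for j
  proof
    assume "q (s j) = q (s (Suc j))"
    from meet[OF sX sX this] obtain k :: int
      where k: "s j + of_int k * L < E (s (Suc j))" "s (Suc j) < E (s j) + of_int k * L" by blast
    have "E (s (Suc j)) \<le> s (Suc (Suc j))" "E (s j) \<le> s (Suc j)"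
      using E_le_greedy s_Suc by metis+
    hence "of_int k * L < 1 * L" "0 * L < of_int k * L" using k short2[of j] by linarith+
    hence "of_int k < (1::real)" "(0::real) < of_int k" using L_pos mult_less_cancel_right_pos by blast+
    thus False by simp
  qed
  \<comment> \<open>The factor 2 pays for the additive 1 in \<open>J_bound\<close> and for the jump
    beyond \<open>T\<close>, each at most one turn.\<close>
  obtain M :: nat where M: "2 * L < of_nat M * d" using ex_less_of_nat_mult d by blast
  have Mpos: "M > 0" using M L_pos by (cases M) auto
  define T where "T = m * M"
  \<comment> \<open>Indices start at 1 so that every member of a class has a predecessor in the
    orbit.\<close>
  define J where "J c = {j \<in> {1..T}. q (s j) = c}" for c
  have J_bound: "real (card (J c)) \<le> (s (Suc T) - s 0) / L + 1" for c
  proof (cases "J c = {}")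
    case True
    have "0 \<le> (s (Suc T) - s 0) / L" using s_mono[of 0 "Suc T"] L_pos by simp
    thus ?thesis using True by simp
  next
    case False
    then obtain j0 where j0: "j0 \<in> J c" by auto
    define u where "u = s j0"
    have uX: "u \<in> X" using sX by (simp add: u_def)
    \<comment> \<open>An overlap after translation by \<open>k\<close> places \<open>u\<close> in a
      window between successive translated orbit points. It is the window at \<open>j\<close> if the
      translate of \<open>s j\<close> starts at or before \<open>u\<close>, and otherwise the
      preceding one, by monotonicity of \<open>greedy\<close>.\<close>
    have "\<exists>i k. (i = j \<or> Suc i = j) \<and> s i + of_int k * L \<le> u \<and> u < s (Suc i) + of_int k * L"
      if j: "j \<in> J c" for j
    proof -
      have "q (s j) = q u" using j j0 by (simp add: J_def u_def)
      from meet[OF sX uX this] obtain k :: int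
        where k: "s j + of_int k * L < E u" "u < E (s j) + of_int k * L" by blast
      show ?thesis
      proof (cases "s j + of_int k * L \<le> u")
        case True
        thus ?thesis using k E_le_greedy[of "s j"] s_Suc[of j] by (intro exI[of _ j] exI[of _ k]) auto
      next
        case False
        obtain i where i: "Suc i = j" using j by (cases j) (auto simp: J_def)
        have "s i + of_int k * L \<le> u"
        proof (rule ccontr)
          assume "\<not> ?thesis"
          hence "greedy u \<le> greedy (s i + of_int k * L)" using uX sX X_shift by (intro greedy_mono) auto
          also have "\<dots> = s j + of_int k * L" using greedy_shift sX s_Suc i by auto
          finally show False using k E_le_greedy[of u] by linarith
        qed
        thus ?thesis using False i by (intro exI[of _ i] exI[of _ k]) auto
      qed
    qed
    then obtain ii kk where ik: "\<And>j. j \<in> J c \<Longrightarrow> ii j = j \<or> Suc (ii j) = j"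
        "\<And>j. j \<in> J c \<Longrightarrow> s (ii j) + of_int (kk j) * L \<le> u"
        "\<And>j. j \<in> J c \<Longrightarrow> u < s (Suc (ii j)) + of_int (kk j :: int) * L" by metis
    \<comment> \<open>Windows under one translation are disjoint, so equal \<open>kk\<close> means
      the same window. The indices are then equal or consecutive, and \<open>consec\<close> excludes
      the latter.\<close>
    have inj: "inj_on kk (J c)"
    proof
      fix j j' assume jj: "j \<in> J c" "j' \<in> J c" "kk j = kk j'"
      have "ii j = ii j'"
      proof (rule linorder_cases)
        assume "ii j < ii j'"
        hence "s (Suc (ii j)) \<le> s (ii j')" by (intro s_mono) auto
        thus ?thesis using ik(3)[OF jj(1)] ik(2)[OF jj(2)] jj(3) by simp
      next
        assume "ii j' < ii j"
        hence "s (Suc (ii j')) \<le> s (ii j)" by (intro s_mono) auto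
        thus ?thesis using ik(3)[OF jj(2)] ik(2)[OF jj(1)] jj(3) by simp
      qed
      hence "j = j' \<or> Suc j = j' \<or> Suc j' = j" using ik(1)[OF jj(1)] ik(1)[OF jj(2)] by auto
      moreover have "q (s j) = q (s j')" using jj(1,2) by (simp add: J_def)
      ultimately show "j = j'" using consec[of j] consec[of j'] by metis
    qed
    \<comment> \<open>Translated back, \<open>u\<close> lies at or above \<open>s 0\<close> and
      strictly below \<open>s (Suc T)\<close>; the strict bound accounts for the
      \<open>+ 1\<close>.\<close>
    define lo where "lo = \<lfloor>(u - s (Suc T)) / L\<rfloor> + 1"
    define hi where "hi = \<lfloor>(u - s 0) / L\<rfloor>"
    have "kk ` J c \<subseteq> {lo..hi}"
    proof (intro image_subsetI)
      fix j assume j: "j \<in> J c"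
      have "Suc (ii j) \<le> Suc T" using ik(1)[OF j] j by (auto simp: J_def)
      hence "u < s (Suc T) + of_int (kk j) * L" using ik(3)[OF j] s_mono by (smt (verit))
      hence "(u - s (Suc T)) / L < of_int (kk j)" using L_pos by (simp add: field_simps)
      hence "lo \<le> kk j" unfolding lo_def by linarith
      moreover have "s 0 + of_int (kk j) * L \<le> u" using ik(2)[OF j] s_mono[of 0 "ii j"] by simp
      hence "of_int (kk j) \<le> (u - s 0) / L" using L_pos by (simp add: field_simps)
      hence "kk j \<le> hi" unfolding hi_def by linarith
      ultimately show "kk j \<in> {lo..hi}" by simp
    qed
    hence le: "card (J c) \<le> nat (hi - lo + 1)"
      using card_mono[of "{lo..hi}" "kk ` J c"] card_image[OF inj] by simp
    \<comment> \<open>Positivity ensures that \<open>nat\<close> in \<open>le\<close> does not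
      truncate.\<close>
    have "card (J c) > 0" using False by (auto simp: J_def card_gt_0_iff)
    hence "real (card (J c)) \<le> of_int hi - of_int lo + 1" using le by linarith
    also have "\<dots> \<le> (u - s 0) / L - (u - s (Suc T)) / L + 1" unfolding hi_def lo_def by linarith
    also have "\<dots> = (s (Suc T) - s 0) / L + 1" by (simp add: diff_divide_distrib)
    finally show ?thesis .
  qed
  have "{1..T} = (\<Union>c\<in>Q. J c)" using col sX by (auto simp: J_def)
  hence "T = card (\<Union>c\<in>Q. J c)" by (metis card_atLeastAtMost diff_Suc_1)
  also have "\<dots> \<le> (\<Sum>c\<in>Q. card (J c))" by (rule card_UN_le[OF fin])
  finally have "real T \<le> (\<Sum>c\<in>Q. real (card (J c)))" by (simp flip: of_nat_sum)
  also have "\<dots> \<le> (\<Sum>c\<in>Q. (s (Suc T) - s 0) / L + 1)" by (rule sum_mono) (rule J_bound)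
  also have "\<dots> = real m * ((s (Suc T) - s 0) / L + 1)" using card by simp
  finally have "real m * real M \<le> real m * ((s (Suc T) - s 0) / L + 1)" by (simp add: T_def)
  hence "real M \<le> (s (Suc T) - s 0) / L + 1" using card by (simp add: mult_le_cancel_left)
  hence 1: "real M * L \<le> s (Suc T) - s 0 + L" using L_pos by (simp add: field_simps)
  have "s (Suc T) \<le> s (T + m)" using card by (intro s_mono) auto
  also have "\<dots> \<le> s T + L" using s_add[of T] d by simp
  also have "s T \<le> s 0 + of_nat M * (L - d)" using s_mult by (simp add: T_def)
  finally show False using 1 M by (simp add: algebra_simps)
qed

end

subsection \<open>Arcs and chords of a circle\<close>

locale circle =
  fixes z :: complex and r :: real
  assumes r_pos: "0 < r"
begin

definition pt :: "real \<Rightarrow> complex" where "pt t = z + of_real r * cis t"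

lemma pt_in_sphere: "pt t \<in> sphere z r"
  using r_pos by (simp add: pt_def dist_norm norm_mult)

lemma pt_eq_iff: "pt t = pt u \<longleftrightarrow> (\<exists>k::int. u = t + of_int k * (2 * pi))"
proof -
  have "pt t = pt u \<longleftrightarrow> sin u = sin t \<and> cos u = cos t"
    using r_pos by (auto simp: pt_def complex_eq_iff)
  also have "\<dots> \<longleftrightarrow> (\<exists>k::int. u = t + of_int k * (2 * pi))"
    by (subst sin_cos_eq_iff) (simp add: mult_ac)
  finally show ?thesis .
qed

lemma pt_shift [simp]: "pt (t + of_int k * (2 * pi)) = pt t"
  using pt_eq_iff by metis

lemma pt_inj_period:
  assumes "pt t = pt u" "\<bar>t - u\<bar> < 2 * pi" shows "t = u"
proof -
  obtain k :: int where k: "u = t + of_int k * (2 * pi)" using assms pt_eq_iff by auto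
  hence "\<bar>of_int k\<bar> * (2 * pi) < 1 * (2 * pi)" using assms(2) by (simp add: abs_mult)
  hence "\<bar>of_int k\<bar> < (1::real)" by (rule mult_right_less_imp_less) auto
  thus ?thesis using k by simp
qed

lemma pt_surj_period:
  assumes "p \<in> sphere z r" shows "\<exists>t. a \<le> t \<and> t < a + 2 * pi \<and> p = pt t"
proof -
  have "norm (p - z) = r" using assms by (simp add: dist_norm norm_minus_commute)
  hence "p = pt (Arg (p - z))" using rcis_cmod_Arg[of "p - z"] by (simp add: pt_def rcis_def)
  moreover obtain k :: int where "a \<le> Arg (p - z) + of_int k * (2 * pi)"
      "Arg (p - z) + of_int k * (2 * pi) < a + 2 * pi"
    using shift_into_period[of "2 * pi"] by auto
  ultimately show ?thesis by (metis pt_shift)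
qed

text \<open>The line through the endpoints of a chord is a level set of the inner product with the
  direction of the midpoint of either arc, which separates the two arcs.\<close>

lemma inner_pt: "cis \<mu> \<bullet> pt t = cis \<mu> \<bullet> z + r * cos (t - \<mu>)"
  by (simp add: pt_def inner_complex_def cos_diff algebra_simps)

lemma inner_pt_arc:
  fixes a b :: real
  assumes "a < b" "b < a + 2 * pi"
  defines "\<mu> \<equiv> (a + b) / 2"
  defines "d \<equiv> cis \<mu> \<bullet> pt a"
  shows "cis \<mu> \<bullet> pt b = d"
    and "\<And>t. a < t \<Longrightarrow> t < b \<Longrightarrow> cis \<mu> \<bullet> pt t > d"
    and "\<And>t. b < t \<Longrightarrow> t < a + 2 * pi \<Longrightarrow> cis \<mu> \<bullet> pt t < d"
proof -
  define h where "h = (b - a) / 2"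
  have h: "0 < h" "h < pi" and ab: "a - \<mu> = - h" "b - \<mu> = h"
    using assms by (simp_all add: h_def \<mu>_def field_simps)
  have d: "d = cis \<mu> \<bullet> z + r * cos h" by (simp add: d_def inner_pt ab)
  show "cis \<mu> \<bullet> pt b = d" by (simp add: d inner_pt ab)
  show "cis \<mu> \<bullet> pt t > d" if "a < t" "t < b" for t
  proof -
    have "cos h < cos \<bar>t - \<mu>\<bar>" using that h ab by (intro cos_monotone_0_pi) auto
    thus ?thesis using r_pos by (simp add: d inner_pt)
  qed
  show "cis \<mu> \<bullet> pt t < d" if "b < t" "t < a + 2 * pi" for t
  proof -
    have "cos (t - \<mu>) < cos h"
    proof (cases "t - \<mu> \<le> pi")
      case True thus ?thesis using that h ab by (intro cos_monotone_0_pi) auto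
    next
      case False
      have "cos (2 * pi - (t - \<mu>)) < cos h" using False that h ab by (intro cos_monotone_0_pi) auto
      thus ?thesis by (simp add: cos_diff)
    qed
    thus ?thesis using r_pos by (simp add: d inner_pt)
  qed
qed

section \<open>Crossing and parallel chords as segments\<close>

text \<open>Rotating by \<open>- \<mu>\<close> makes the line vertical with real part
  \<open>r * cos h\<close>. The disc then bounds the imaginary part by \<open>r * sin h\<close>, and
  \<open>l\<close> is the resulting position between the two ends.\<close>

lemma line_inter_disc:
  assumes ab: "a < b" "b < a + 2 * pi"
    and y: "y \<in> cball z r" "cis ((a + b) / 2) \<bullet> y = cis ((a + b) / 2) \<bullet> pt a"
  shows "y \<in> closed_segment (pt a) (pt b)"
proof -
  define \<mu> where "\<mu> = (a + b) / 2"
  define h where "h = (b - a) / 2"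
  have h: "0 < h" "h < pi" and ab': "a = \<mu> - h" "b = \<mu> + h"
    using ab by (simp_all add: h_def \<mu>_def field_simps)
  have sh: "sin h > 0" using h by (simp add: sin_gt_zero)
  define w where "w = (y - z) * cis (- \<mu>)"
  have yw: "y = z + w * cis \<mu>" by (simp add: w_def mult.assoc cis_mult)
  have "norm w \<le> r" using y(1) by (simp add: w_def norm_mult dist_norm norm_minus_commute)
  hence "(Re w)\<^sup>2 + (Im w)\<^sup>2 \<le> r\<^sup>2" using r_pos
    by (metis cmod_power2 norm_ge_zero power_mono)
  moreover have Re: "Re w = r * cos h"
  proof -
    have "Re w = cis \<mu> \<bullet> y - cis \<mu> \<bullet> z" by (simp add: w_def inner_complex_def algebra_simps)
    also have "\<dots> = cis \<mu> \<bullet> pt a - cis \<mu> \<bullet> z" using y(2) by (simp add: \<mu>_def)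
    also have "\<dots> = r * cos h" using ab' by (simp add: inner_pt)
    finally show ?thesis .
  qed
  moreover have "r\<^sup>2 = (r * cos h)\<^sup>2 + (r * sin h)\<^sup>2"
    by (simp add: power_mult_distrib flip: distrib_left)
  ultimately have "(Im w)\<^sup>2 \<le> (r * sin h)\<^sup>2" by simp
  hence "\<bar>Im w\<bar> \<le> r * sin h" using r_pos sh by (metis abs_le_square_iff abs_of_pos mult_pos_pos)
  hence B: "- (r * sin h) \<le> Im w" "Im w \<le> r * sin h" by auto
  define l where "l = (Im w + r * sin h) / (2 * (r * sin h))"
  have l: "0 \<le> l" "l \<le> 1" using B r_pos sh by (auto simp: l_def divide_simps)
  have lim: "l * (2 * (r * sin h)) = Im w + r * sin h" using r_pos sh by (simp add: l_def)
  have "w = (1 - l) *\<^sub>R (of_real r * cis (- h)) + l *\<^sub>R (of_real r * cis h)"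
    using lim Re by (simp add: complex_eq_iff algebra_simps)
  moreover have "of_real r * cis (- h) * cis \<mu> = of_real r * cis a"
      "of_real r * cis h * cis \<mu> = of_real r * cis b"
    by (simp_all add: mult.assoc cis_mult ab' add.commute)
  ultimately have "w * cis \<mu> = (1 - l) *\<^sub>R (of_real r * cis a) + l *\<^sub>R (of_real r * cis b)"
    by (simp only: distrib_right mult_scaleR_left)
  hence "y = (1 - l) *\<^sub>R pt a + l *\<^sub>R pt b"
    by (simp add: yw pt_def algebra_simps scaleR_conv_of_real)
  thus ?thesis using l by (auto simp: in_segment)
qed

text \<open>The ends of the second chord lie strictly on opposite sides of the line through the
  first. By the intermediate value theorem its segment meets this line, at a point of the disc and
  hence of the first chord.\<close>

lemma chords_intersect_crossing:
  assumes "a < c" "c < b" "b < d" "d < a + 2 * pi"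
  shows "chords_intersect {pt a, pt b} {pt c, pt d}"
proof -
  define \<mu> where "\<mu> = (a + b) / 2"
  have 1: "cis \<mu> \<bullet> pt c > cis \<mu> \<bullet> pt a" "cis \<mu> \<bullet> pt d < cis \<mu> \<bullet> pt a"
    unfolding \<mu>_def using assms by (auto intro!: inner_pt_arc)
  have "\<exists>y\<in>closed_segment (pt c) (pt d). cis \<mu> \<bullet> y = cis \<mu> \<bullet> pt a"
    by (rule connected_ivt_hyperplane[of _ "pt d" "pt c"]) (use 1 in auto)
  then obtain y where y: "y \<in> closed_segment (pt c) (pt d)" "cis \<mu> \<bullet> y = cis \<mu> \<bullet> pt a" by auto
  have "closed_segment (pt c) (pt d) \<subseteq> cball z r"
    using pt_in_sphere by (intro closed_segment_subset) auto
  hence "y \<in> closed_segment (pt a) (pt b)"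
    using assms y by (intro line_inter_disc) (auto simp: \<mu>_def)
  thus ?thesis using y by (auto simp: chords_intersect_def segment_convex_hull)
qed

text \<open>The line through the first chord has both ends of the second strictly on one side, and
  half-planes are convex.\<close>

lemma not_chords_intersect_parallel:
  assumes "a < b" "b < c" "c < d" "d < a + 2 * pi"
  shows "\<not> chords_intersect {pt a, pt b} {pt c, pt d}"
proof -
  define \<mu> where "\<mu> = (a + b) / 2"
  define e where "e = cis \<mu> \<bullet> pt a"
  have "cis \<mu> \<bullet> pt b = e" unfolding \<mu>_def e_def using assms by (intro inner_pt_arc) auto
  hence 1: "convex hull {pt a, pt b} \<subseteq> {u. cis \<mu> \<bullet> u \<ge> e}"
    by (intro hull_minimal convex_halfspace_ge) (auto simp: e_def)
  have "cis \<mu> \<bullet> pt c < e" "cis \<mu> \<bullet> pt d < e"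
    unfolding \<mu>_def e_def using assms by (auto intro!: inner_pt_arc(3))
  hence 2: "convex hull {pt c, pt d} \<subseteq> {u. cis \<mu> \<bullet> u < e}"
    by (intro hull_minimal convex_halfspace_lt) auto
  from 1 2 show ?thesis by (fastforce simp: chords_intersect_def)
qed

lemma continuous_on_pt: "continuous_on A pt"
  unfolding pt_def by (intro continuous_intros)

text \<open>The two images are connected and lie in opposite open half-planes of the line through
  the endpoints, so no connected part of the punctured circle meets both.\<close>

lemma arcs_of_pt:
  assumes ab: "a < b" "b < a + 2 * pi"
  shows "arcs_of (sphere z r) {pt a, pt b} = {pt ` {a<..<b}, pt ` {b<..<a + 2 * pi}}"
proof -
  define U where "U = pt ` {a<..<b}"
  define V where "V = pt ` {b<..<a + 2 * pi}"
  define W where "W = sphere z r - {pt a, pt b}"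
  define \<mu> where "\<mu> = (a + b) / 2"
  define e where "e = cis \<mu> \<bullet> pt a"
  have Uh: "U \<subseteq> {u. cis \<mu> \<bullet> u > e}" unfolding U_def e_def \<mu>_def using ab by (auto intro!: inner_pt_arc)
  have Vh: "V \<subseteq> {u. cis \<mu> \<bullet> u < e}" unfolding V_def e_def \<mu>_def using ab by (auto intro!: inner_pt_arc)
  have e: "cis \<mu> \<bullet> pt a = e" "cis \<mu> \<bullet> pt b = e"
    unfolding e_def \<mu>_def using ab by (auto intro!: inner_pt_arc)
  have WUV: "W = U \<union> V"
  proof
    show "U \<union> V \<subseteq> W" using Uh Vh e pt_in_sphere by (auto simp: W_def U_def V_def)
    show "W \<subseteq> U \<union> V"
    proof
      fix p assume p: "p \<in> W"
      then obtain t where t: "a \<le> t" "t < a + 2 * pi" "p = pt t"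
        using pt_surj_period[of p a] by (auto simp: W_def)
      moreover have "t \<noteq> a" "t \<noteq> b" using p t by (auto simp: W_def)
      ultimately have "t \<in> {a<..<b} \<or> t \<in> {b<..<a + 2 * pi}" by auto
      thus "p \<in> U \<union> V" using t(3) by (auto simp: U_def V_def)
    qed
  qed
  have max: "K = T" if "K \<in> {U, V}" "connected T" "K \<subseteq> T" "T \<subseteq> W" for K T
  proof -
    have "K \<noteq> {}" using that ab by (auto simp: U_def V_def)
    have "{u. e < cis \<mu> \<bullet> u} \<inter> T = {} \<or> {u. cis \<mu> \<bullet> u < e} \<inter> T = {}"
    proof (rule connectedD[OF \<open>connected T\<close> open_halfspace_gt open_halfspace_lt])
      show "{u. e < cis \<mu> \<bullet> u} \<inter> {u. cis \<mu> \<bullet> u < e} \<inter> T = {}" by auto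
      show "T \<subseteq> {u. e < cis \<mu> \<bullet> u} \<union> {u. cis \<mu> \<bullet> u < e}" using that(4) Uh Vh WUV by auto
    qed
    thus ?thesis using that Uh Vh WUV \<open>K \<noteq> {}\<close> by blast
  qed
  have conn: "connected U" "connected V" unfolding U_def V_def
    by (auto intro!: connected_continuous_image continuous_on_pt)
  have ne: "U \<noteq> {}" "V \<noteq> {}" using ab by (auto simp: U_def V_def)
  have "components W = {U, V}"
  proof
    show "{U, V} \<subseteq> components W"
      using conn ne max WUV unfolding in_components_maximal subset_iff by blast
    show "components W \<subseteq> {U, V}"
    proof
      fix K assume K: "K \<in> components W"
      have "K \<noteq> {}" "K \<subseteq> W" "connected K"
        using K in_components_nonempty in_components_subset in_components_connected by metis+
      then obtain p where p: "p \<in> K" "p \<in> U \<or> p \<in> V" using WUV by auto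
      have "U \<in> components W" "V \<in> components W" using \<open>{U, V} \<subseteq> components W\<close> by auto
      thus "K \<in> {U, V}" using components_eq[OF K] p by blast
    qed
  qed
  thus ?thesis by (simp add: arcs_of_def W_def U_def V_def)
qed

end

subsection \<open>Empty arcs\<close>

locale chord_diagram = circle +
  fixes \<C> :: "chord set"
  assumes finite_chords: "finite \<C>"
    and is_chord: "\<And>c. c \<in> \<C> \<Longrightarrow> is_chord (sphere z r) c"
    and disjoint: "disjoint \<C>"
begin

section \<open>Lifting chord endpoints to the real line\<close>

abbreviation L :: real where "L \<equiv> 2 * pi"

definition ends :: "real set" where "ends = {a. pt a \<in> \<Union>\<C>}"

text \<open>The next lift of the other endpoint. A lifted endpoint \<open>a\<close> thus names one
  arc of its chord, from \<open>a\<close> to \<open>mate a\<close>; the opposite arc is named by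
  \<open>mate a\<close>, since it ends at \<open>a + L\<close>.\<close>

definition mate :: "real \<Rightarrow> real" where
  "mate a = (SOME b. a < b \<and> b < a + L \<and> {pt a, pt b} \<in> \<C>)"

definition chord_at :: "real \<Rightarrow> chord" where "chord_at a = {pt a, pt (mate a)}"

lemma chord_unique: "c \<in> \<C> \<Longrightarrow> d \<in> \<C> \<Longrightarrow> p \<in> c \<Longrightarrow> p \<in> d \<Longrightarrow> c = d"
  using disjoint by (auto simp: disjoint_def pairwise_def disjnt_iff)

lemma mate_ex:
  assumes "c \<in> \<C>" "pt a \<in> c"
  shows "\<exists>b. a < b \<and> b < a + L \<and> c = {pt a, pt b}"
proof -
  have "card c = 2" "c \<subseteq> sphere z r" using is_chord[OF assms(1)] by (auto simp: is_chord_def)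
  then obtain q where q: "c = {pt a, q}" "q \<noteq> pt a" using assms(2) by (auto simp: card_2_iff)
  with \<open>c \<subseteq> sphere z r\<close> obtain b where "a \<le> b" "b < a + L" "q = pt b"
    using pt_surj_period[of q a] by auto
  thus ?thesis using q by (intro exI[of _ b]) (auto simp: order_less_le)
qed

lemma mate_props:
  assumes "a \<in> ends"
  shows less_mate: "a < mate a" and mate_less: "mate a < a + L" and chord_at_in: "chord_at a \<in> \<C>"
proof -
  have "\<exists>b. a < b \<and> b < a + L \<and> {pt a, pt b} \<in> \<C>" using assms mate_ex unfolding ends_def by blast
  from someI_ex[OF this] show "a < mate a" "mate a < a + L" "chord_at a \<in> \<C>"
    by (auto simp: mate_def chord_at_def)
qed

lemma mate_eqI:
  assumes "a < b" "b < a + L" "{pt a, pt b} \<in> \<C>"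
  shows "mate a = b"
proof -
  have a: "a \<in> ends" using assms(3) by (auto simp: ends_def)
  have "chord_at a = {pt a, pt b}"
    using assms(3) chord_at_in[OF a] by (intro chord_unique[of _ _ "pt a"]) (auto simp: chord_at_def)
  moreover have "pt a \<noteq> pt b" using pt_inj_period[of a b] assms by auto
  ultimately have "pt (mate a) = pt b" by (auto simp: chord_at_def doubleton_eq_iff)
  thus ?thesis using pt_inj_period[of "mate a" b] less_mate[OF a] mate_less[OF a] assms by auto
qed

lemma ends_shift [simp]: "a + of_int k * L \<in> ends \<longleftrightarrow> a \<in> ends"
  by (simp add: ends_def)

lemma ends_shift1 [simp]: "a + L \<in> ends \<longleftrightarrow> a \<in> ends"
  using ends_shift[of a 1] by simp

lemma pt_shift1 [simp]: "pt (a + L) = pt a"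
  using pt_shift[of a 1] by simp

lemma mate_shift: "a \<in> ends \<Longrightarrow> mate (a + of_int k * L) = mate a + of_int k * L"
  using mate_props[of a] by (intro mate_eqI) (auto simp: chord_at_def)

lemma mate_in_ends: "a \<in> ends \<Longrightarrow> mate a \<in> ends"
  using chord_at_in[of a] unfolding ends_def chord_at_def by blast

lemma mate_mate:
  assumes "a \<in> ends" shows "mate (mate a) = a + L"
proof (rule mate_eqI)
  show "{pt (mate a), pt (a + L)} \<in> \<C>"
    using chord_at_in[OF assms] by (simp add: chord_at_def insert_commute)
qed (use mate_props[OF assms] in auto)

lemma mate_inj: "a \<in> ends \<Longrightarrow> b \<in> ends \<Longrightarrow> mate a = mate b \<Longrightarrow> a = b"
  using mate_mate by (metis add_right_cancel)

lemma chord_at_shift: "a \<in> ends \<Longrightarrow> chord_at (a + of_int k * L) = chord_at a"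
  by (simp add: chord_at_def mate_shift)

lemma chord_at_mate: "a \<in> ends \<Longrightarrow> chord_at (mate a) = chord_at a"
  unfolding chord_at_def by (simp add: mate_mate insert_commute)

lemma chord_at_eq:
  assumes "a \<in> ends" "b \<in> ends"
  shows "chord_at a = chord_at b \<longleftrightarrow>
    (\<exists>k::int. b = a + of_int k * L) \<or> (\<exists>k::int. b = mate a + of_int k * L)"
proof
  assume "chord_at a = chord_at b"
  hence "pt a = pt b \<or> pt (mate a) = pt b" by (auto simp: chord_at_def doubleton_eq_iff)
  thus "(\<exists>k::int. b = a + of_int k * L) \<or> (\<exists>k::int. b = mate a + of_int k * L)"
    by (simp add: pt_eq_iff)
next
  assume "(\<exists>k::int. b = a + of_int k * L) \<or> (\<exists>k::int. b = mate a + of_int k * L)"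
  thus "chord_at a = chord_at b"
    using assms by (auto simp: chord_at_shift mate_in_ends chord_at_mate)
qed

lemma chord_obtain:
  assumes "c \<in> \<C>" obtains a where "a \<in> ends" "c = chord_at a"
proof -
  have c: "card c = 2" "c \<subseteq> sphere z r" using is_chord[OF assms(1)] by (auto simp: is_chord_def)
  hence "c \<noteq> {}" by auto
  then obtain p where p: "p \<in> c" "p \<in> sphere z r" using c by blast
  then obtain a where a: "p = pt a" using pt_surj_period by blast
  have "a \<in> ends" using p assms a by (auto simp: ends_def)
  moreover have "c = chord_at a"
    using chord_at_in[OF \<open>a \<in> ends\<close>] p a assms
    by (intro chord_unique[of _ _ p]) (auto simp: chord_at_def)
  ultimately show ?thesis using that by blast
qed

lemma finite_ends_interval: "finite (ends \<inter> {a..b})"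
proof -
  have fin: "finite (ends \<inter> {c..<c + L})" for c
  proof (rule finite_imageD)
    have "finite (\<Union>\<C>)"
      using finite_chords is_chord by (force simp: is_chord_def intro: card_ge_0_finite)
    thus "finite (pt ` (ends \<inter> {c..<c + L}))" by (rule finite_subset[rotated]) (auto simp: ends_def)
    show "inj_on pt (ends \<inter> {c..<c + L})" by (intro inj_onI pt_inj_period) auto
  qed
  have "finite (ends \<inter> {a..<a + of_nat n * L})" for n
  proof (induction n)
    case (Suc n)
    have "ends \<inter> {a..<a + of_nat (Suc n) * L} \<subseteq>
        (ends \<inter> {a..<a + of_nat n * L}) \<union> (ends \<inter> {a + of_nat n * L..<(a + of_nat n * L) + L})"
      by (auto simp: algebra_simps)
    thus ?case using Suc fin by (meson finite_UnI finite_subset)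
  qed simp
  moreover obtain n :: nat where "b - a < of_nat n * L" using ex_less_of_nat_mult[of L] by auto
  hence "ends \<inter> {a..b} \<subseteq> ends \<inter> {a..<a + of_nat n * L}" by auto
  ultimately show ?thesis by (meson finite_subset)
qed

text \<open>The left ends of the lifts of empty arcs.\<close>

definition starts :: "real set" where
  "starts = {a \<in> ends. \<not> (\<exists>b\<in>ends. a < b \<and> mate b < mate a)}"

lemma starts_ends: "a \<in> starts \<Longrightarrow> a \<in> ends"
  by (simp add: starts_def)

lemma starts_noninclusion: "a \<in> starts \<Longrightarrow> b \<in> ends \<Longrightarrow> a < b \<Longrightarrow> mate a < mate b"
  using mate_inj[of a b] by (force simp: starts_def)

lemma starts_shift:
  assumes a: "a \<in> starts" shows "a + of_int k * L \<in> starts"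
proof -
  have False if b: "b \<in> ends" "a + of_int k * L < b" "mate b < mate (a + of_int k * L)" for b
  proof -
    have "b + of_int (-k) * L \<in> ends" "a < b + of_int (-k) * L" "mate (b + of_int (-k) * L) < mate a"
      using b a mate_shift[of b "-k"] by (auto simp: starts_ends mate_shift simp del: of_int_minus)
    thus False using a by (auto simp: starts_def)
  qed
  thus ?thesis using a by (auto simp: starts_def)
qed

text \<open>Descent: an arc that is not empty contains a smaller one, which loses the endpoint
  \<open>a\<close> and so has fewer lifted endpoints.\<close>

lemma arc_contains_empty:
  assumes "a \<in> ends"
  shows "\<exists>x\<in>starts. a \<le> x \<and> mate x \<le> mate a"
proof -
  define n where "n = card (ends \<inter> {a..mate a})"
  show ?thesis using n_def assms
  proof (induction n arbitrary: a rule: less_induct)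
    case (less n)
    show ?case
    proof (cases "a \<in> starts")
      case False
      then obtain b where b: "b \<in> ends" "a < b" "mate b < mate a"
        using less.prems by (auto simp: starts_def)
      have "a \<in> ends \<inter> {a..mate a} - ends \<inter> {b..mate b}"
        using b less.prems less_mate[of a] by auto
      moreover have "ends \<inter> {b..mate b} \<subseteq> ends \<inter> {a..mate a}" using b by auto
      ultimately have "ends \<inter> {b..mate b} \<subset> ends \<inter> {a..mate a}" by blast
      hence "card (ends \<inter> {b..mate b}) < n"
        unfolding less.prems(1) by (intro psubset_card_mono finite_ends_interval)
      from less.IH[OF this refl b(1)] obtain x where "x \<in> starts" "b \<le> x" "mate x \<le> mate b" by blast
      thus ?thesis using b by (intro bexI[of _ x]) auto
    qed auto
  qed
qed

lemma arcs_of_chord_at: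
  assumes "a \<in> ends"
  shows "arcs_of (sphere z r) (chord_at a) = {pt ` {a<..<mate a}, pt ` {mate a<..<mate (mate a)}}"
  using arcs_of_pt[of a "mate a"] mate_props[OF assms] by (simp add: chord_at_def mate_mate assms)

lemma empty_arc_iff:
  assumes a: "a \<in> ends"
  shows "empty_arc \<C> (pt ` {a<..<mate a}) \<longleftrightarrow> a \<in> starts"
proof
  assume e: "empty_arc \<C> (pt ` {a<..<mate a})"
  have False if "b \<in> ends" "a < b" "mate b < mate a" for b
  proof -
    have "chord_at b \<subseteq> pt ` {a<..<mate a}" using that less_mate[of b] by (auto simp: chord_at_def)
    thus False using e that chord_at_in by (auto simp: empty_arc_def)
  qed
  thus "a \<in> starts" using a by (auto simp: starts_def)
next
  assume s: "a \<in> starts"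
  have False if c: "c \<in> \<C>" "c \<subseteq> pt ` {a<..<mate a}" for c
  proof -
    obtain p q where pq: "c = {p, q}" "p \<noteq> q" using is_chord[OF c(1)] by (auto simp: is_chord_def card_2_iff)
    then obtain u v where uv: "p = pt u" "q = pt v" "u \<in> {a<..<mate a}" "v \<in> {a<..<mate a}"
      using c(2) by auto
    \<comment> \<open>Two ends of a chord inside one lifted arc are less than a period apart, so the
      later is the mate of the earlier and gives a nested arc.\<close>
    have *: False if "u < v" "{pt u, pt v} \<in> \<C>" "u \<in> {a<..<mate a}" "v \<in> {a<..<mate a}" for u v
    proof -
      have "mate u = v" using that mate_less[OF a] by (intro mate_eqI) auto
      moreover have "u \<in> ends" using that by (auto simp: ends_def)
      ultimately show False using s that by (auto simp: starts_def)
    qed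
    show False using *[of u v] *[of v u] uv pq c by (force simp: insert_commute)
  qed
  thus "empty_arc \<C> (pt ` {a<..<mate a})" by (auto simp: empty_arc_def)
qed

lemma peripheral_eq: "peripheral_chords (sphere z r) \<C> = chord_at ` starts"
proof
  show "chord_at ` starts \<subseteq> peripheral_chords (sphere z r) \<C>"
    using empty_arc_iff starts_ends by (auto simp: peripheral_chords_def arcs_of_chord_at chord_at_in)
  show "peripheral_chords (sphere z r) \<C> \<subseteq> chord_at ` starts"
  proof
    fix c assume c: "c \<in> peripheral_chords (sphere z r) \<C>"
    then obtain a where a: "a \<in> ends" "c = chord_at a"
      using chord_obtain by (auto simp: peripheral_chords_def)
    hence "a \<in> starts \<or> mate a \<in> starts"
      using c empty_arc_iff[of a] empty_arc_iff[of "mate a"] mate_in_ends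
      by (auto simp: peripheral_chords_def arcs_of_chord_at)
    thus "c \<in> chord_at ` starts" using a chord_at_mate by auto
  qed
qed

section \<open>Overlap of arcs against crossing of chords\<close>

text \<open>Overlap of the two open arcs on the circle, expressed on the cover by a suitable
  translation.\<close>

definition meets :: "real \<Rightarrow> real \<Rightarrow> bool" where
  "meets x y \<longleftrightarrow> (\<exists>k::int. x + of_int k * L < mate y \<and> y < mate x + of_int k * L)"

lemma meets_sym: "meets x y \<Longrightarrow> meets y x"
  unfolding meets_def by (elim exE, rule_tac x = "-k" in exI) auto

lemma meets_shift: "y \<in> ends \<Longrightarrow> meets x (y + of_int k * L) \<longleftrightarrow> meets x y"
proof -
  have "meets x (y + of_int k * L)" if y: "y \<in> ends" "meets x y" for y k
  proof -
    obtain l :: int where "x + of_int l * L < mate y" "y < mate x + of_int l * L"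
      using y(2) unfolding meets_def by blast
    hence "x + of_int (l + k) * L < mate (y + of_int k * L)"
        "y + of_int k * L < mate x + of_int (l + k) * L"
      unfolding mate_shift[OF y(1)] of_int_add distrib_right by linarith+
    thus ?thesis unfolding meets_def by blast
  qed
  from this[of y k] this[of "y + of_int k * L" "-k"]
  show "y \<in> ends \<Longrightarrow> meets x (y + of_int k * L) \<longleftrightarrow> meets x y" by auto
qed

lemma mate_meets: "y \<in> ends \<Longrightarrow> y < mate x \<Longrightarrow> x < mate y \<Longrightarrow> meets x y"
  unfolding meets_def by (intro exI[of _ 0]) auto

lemma meets_same: "x \<in> ends \<Longrightarrow> meets x (x + of_int k * L)"
  by (simp add: meets_shift mate_meets less_mate)

text \<open>Empty arcs that overlap are not nested, so their endpoints interleave.\<close>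

lemma meets_imp_intersect:
  assumes xy: "x \<in> starts" "y \<in> starts" and m: "meets x y" and ne: "chord_at x \<noteq> chord_at y"
  shows "chords_intersect (chord_at x) (chord_at y)"
proof -
  have *: "chords_intersect (chord_at x) (chord_at y)"
    if xy: "x \<in> starts" "y \<in> starts" "x < y" "y < mate x" for x y
  proof -
    have e: "x \<in> ends" "y \<in> ends" using xy starts_ends by auto
    have 1: "mate x < mate y" using xy e starts_noninclusion by blast
    \<comment> \<open>Emptiness of the arc at \<open>y\<close> is applied to the opposite arc of
      \<open>x\<close>, which runs from \<open>mate x\<close> to \<open>x + L\<close>.\<close>
    have 2: "mate y < x + L"
    proof (rule ccontr)
      assume "\<not> ?thesis"
      moreover have "mate (mate x) < mate y \<or> mate (mate x) = mate y"
        using calculation e by (auto simp: mate_mate)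
      moreover have "mate y < mate (mate x)"
        using starts_noninclusion[of y "mate x"] xy e by (auto simp: mate_in_ends)
      ultimately show False by auto
    qed
    show ?thesis unfolding chord_at_def using xy 1 2 by (intro chords_intersect_crossing) auto
  qed
  obtain k :: int where k: "x + of_int k * L < mate y" "y < mate x + of_int k * L"
    using m by (auto simp: meets_def)
  define x' where "x' = x + of_int k * L"
  have x': "x' \<in> starts" "chord_at x' = chord_at x" "mate x' = mate x + of_int k * L"
    using xy starts_shift starts_ends by (auto simp: x'_def chord_at_shift mate_shift)
  have "x' \<noteq> y" using x' ne by auto
  thus ?thesis using *[of x' y] *[of y x'] xy x' k
    by (cases "x' < y") (auto simp: x'_def chords_intersect_def Int_commute)
qed

text \<open>By contraposition: arcs of distinct chords that do not overlap leave the endpoints in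
  parallel order.\<close>

lemma intersect_imp_meets:
  assumes x: "x \<in> ends" and y: "y \<in> ends" and ne: "chord_at x \<noteq> chord_at y"
    and int: "chords_intersect (chord_at x) (chord_at y)"
  shows "meets x y"
proof -
  obtain k where k: "x \<le> y + of_int k * L" "y + of_int k * L < x + L"
    using shift_into_period[of L x y] by auto
  define y' where "y' = y + of_int k * L"
  have y': "y' \<in> ends" "chord_at y' = chord_at y" using y by (auto simp: y'_def chord_at_shift)
  have "meets x y'"
  proof (rule ccontr)
    assume n: "\<not> meets x y'"
    have xy': "x < mate y'" using k less_mate[OF y'(1)] by (simp add: y'_def)
    hence 1: "mate x \<le> y'" using n y' mate_meets[of y' x] by force
    \<comment> \<open>An arc reaching beyond \<open>x + L\<close> would run into the next translate
      of the arc at \<open>x\<close>, hence the witness 1.\<close>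
    have 2: "mate y' \<le> x + L"
    proof (rule ccontr)
      assume "\<not> ?thesis"
      hence "meets x y'" unfolding meets_def
        using k less_mate[OF x] by (intro exI[of _ 1]) (auto simp: y'_def)
      thus False using n by blast
    qed
    have "chord_at (x + L) = chord_at x" using chord_at_shift[OF x, of 1] by simp
    hence "mate x \<noteq> y'" "mate y' \<noteq> x + L"
      using ne y' chord_at_mate[OF x] chord_at_mate[OF y'(1)] by auto
    hence "\<not> chords_intersect (chord_at x) (chord_at y')" unfolding chord_at_def
      using 1 2 less_mate[OF x] less_mate[OF y'(1)] by (intro not_chords_intersect_parallel) auto
    thus False using int y' by simp
  qed
  thus ?thesis using meets_shift[OF y] by (simp add: y'_def)
qed

text \<open>Both arcs of the chord at \<open>x\<close> are empty. An arc of another chord therefore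
  does not fit into the opposite arc and reaches the arc at \<open>x\<close> or its next
  translate.\<close>

lemma double_start_meets:
  assumes x: "x \<in> starts" "mate x \<in> starts" and y: "y \<in> ends" and ne: "chord_at x \<noteq> chord_at y"
  shows "meets x y"
proof -
  have xe: "x \<in> ends" using x starts_ends by auto
  obtain k where k: "x \<le> y + of_int k * L" "y + of_int k * L < x + L"
    using shift_into_period[of L x y] by auto
  define y' where "y' = y + of_int k * L"
  have y': "y' \<in> ends" "chord_at y' = chord_at y" using y by (auto simp: y'_def chord_at_shift)
  have "meets x y'"
  proof (cases "y' < mate x")
    case True
    thus ?thesis using k less_mate[OF y'(1)] y' by (intro mate_meets) (auto simp: y'_def)
  next
    case False
    moreover have "y' \<noteq> mate x" using ne y' chord_at_mate[OF xe] by auto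
    ultimately have "mate (mate x) < mate y'" using starts_noninclusion[of "mate x" y'] x y' by auto
    thus ?thesis unfolding meets_def using k xe less_mate[OF xe]
      by (intro exI[of _ 1]) (auto simp: mate_mate y'_def)
  qed
  thus ?thesis using meets_shift[OF y] by (simp add: y'_def)
qed

section \<open>Non-crossing chords and disjoint empty arcs\<close>

lemma parallel_lift_aux:
  assumes a: "a \<in> ends" and u: "u \<in> ends" "mate a < u" "u < a + L"
    and ni: "\<not> chords_intersect (chord_at a) (chord_at u)"
  shows "\<exists>v\<in>ends. mate a < v \<and> mate v < a + L \<and> chord_at v = chord_at u"
proof -
  have m: "mate u \<noteq> a + L" "mate u \<noteq> mate a + L"
    using mate_inj[of u "mate a"] mate_inj[of u "a + L"] mate_shift[OF a, of 1] a u less_mate[OF a]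
    by (auto simp: mate_mate mate_in_ends)
  consider "mate u < a + L" | "a + L < mate u" "mate u < mate a + L" | "mate a + L < mate u"
    using m by linarith
  thus ?thesis
  proof cases
    case 1 thus ?thesis using u by blast
  next
    case 2
    have "chords_intersect {pt u, pt (mate u)} {pt (a + L), pt (mate a + L)}"
      using u 2 by (intro chords_intersect_crossing) auto
    hence False using ni by (simp add: chord_at_def chords_intersect_def Int_commute)
    thus ?thesis ..
  next
    case 3
    \<comment> \<open>The arc at \<open>u\<close> covers the whole next translate of the arc at
      \<open>a\<close>. Its opposite arc, moved back by one period, is the one that fits.\<close>
    define v where "v = mate u + of_int (-1) * L"
    have "v \<in> ends" "chord_at v = chord_at u" "mate v = u"
      unfolding v_def ends_shift using u mate_in_ends[of u] chord_at_shift[of "mate u" "-1"]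
        mate_shift[of "mate u" "-1"]
      by (auto simp: chord_at_mate mate_mate simp del: of_int_minus)
    thus ?thesis using 3 u by (intro bexI[of _ v]) (auto simp: v_def)
  qed
qed

text \<open>An endpoint of \<open>d\<close> lies in one of the arcs of \<open>c\<close>; naming
  \<open>c\<close> by the start of the other arc reduces both cases to
  \<open>parallel_lift_aux\<close>.\<close>

lemma parallel_lift:
  assumes c: "c \<in> \<C>" and d: "d \<in> \<C>" and ne: "c \<noteq> d" and ni: "\<not> chords_intersect c d"
  obtains a v where "a \<in> ends" "v \<in> ends" "mate a < v" "mate v < a + L"
proof -
  obtain a where a: "a \<in> ends" "c = chord_at a" using chord_obtain[OF c] .
  obtain u0 where u0: "u0 \<in> ends" "d = chord_at u0" using chord_obtain[OF d] .
  obtain k where k: "a \<le> u0 + of_int k * L" "u0 + of_int k * L < a + L"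
    using shift_into_period[of L a u0] by auto
  define u where "u = u0 + of_int k * L"
  have u: "u \<in> ends" "d = chord_at u" using u0 by (auto simp: u_def chord_at_shift)
  have uL: "chord_at (u + L) = chord_at u" using chord_at_shift[of u 1] u by simp
  have "u \<noteq> mate a" "u \<noteq> a" using ne a u chord_at_mate by auto
  then consider "mate a < u" | "a < u" "u < mate a" using k by (force simp: u_def)
  thus ?thesis
  proof cases
    case 1
    thus ?thesis using parallel_lift_aux[of a u] a u ni k that by (auto simp: u_def)
  next
    case 2
    have "\<exists>v\<in>ends. mate (mate a) < v \<and> mate v < mate a + L \<and> chord_at v = chord_at (u + L)"
      using 2 a u ni uL by (intro parallel_lift_aux) (auto simp: mate_mate mate_in_ends chord_at_mate)
    thus ?thesis using that[of "mate a"] a mate_in_ends by blast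
  qed
qed

text \<open>Disjoint arcs contain disjoint empty arcs. This forces at least two cliques in every
  cover, as \<open>greedy_wraps\<close> demands.\<close>

lemma parallel_peripheral:
  assumes c: "c \<in> \<C>" and d: "d \<in> \<C>" and ne: "c \<noteq> d" and ni: "\<not> chords_intersect c d"
  shows "\<exists>x\<in>starts. \<exists>y\<in>starts. chord_at x \<noteq> chord_at y \<and>
           \<not> chords_intersect (chord_at x) (chord_at y)"
proof -
  obtain a v where av: "a \<in> ends" "v \<in> ends" "mate a < v" "mate v < a + L"
    using parallel_lift[OF c d ne ni] .
  obtain x where x: "x \<in> starts" "a \<le> x" "mate x \<le> mate a" using arc_contains_empty[OF av(1)] by blast
  obtain y where y: "y \<in> starts" "v \<le> y" "mate y \<le> mate v" using arc_contains_empty[OF av(2)] by blast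
  have e: "x \<in> ends" "y \<in> ends" using x y starts_ends by auto
  \<comment> \<open>The first bound is not strict so that \<open>no\<close> also excludes that
    \<open>y\<close> starts the opposite arc of \<open>x\<close>.\<close>
  have no: False if "mate x + of_int k * L \<ge> y" "x + of_int k * L < mate y" for k :: int
  proof -
    have "0 * L < of_int k * L" "of_int k * L < 1 * L" using that x y av by linarith+
    hence "0 < k" "k < 1" by (simp_all add: zero_less_mult_iff)
    thus False by simp
  qed
  have nm: "\<not> meets x y" using no by (force simp: meets_def)
  have "chord_at x \<noteq> chord_at y"
  proof
    assume "chord_at x = chord_at y"
    then consider k :: int where "y = x + of_int k * L" | k :: int where "y = mate x + of_int k * L"
      using chord_at_eq e by blast
    thus False
    proof cases
      case 1 thus False using nm meets_same e by blast
    next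
      case (2 k)
      hence "x + of_int k * L < mate y" using less_mate e by (metis add_less_cancel_right less_trans)
      thus False using no[of k] 2 by simp
    qed
  qed
  thus ?thesis using x y nm intersect_imp_meets e by blast
qed

section \<open>Corners from cliques and cliques from corners\<close>

lemma periodic_intervals_starts:
  assumes "\<C> \<noteq> {}" shows "periodic_intervals L starts mate"
proof
  show "starts \<noteq> {}" using assms chord_obtain arc_contains_empty by (metis all_not_in_conv)
  show "finite (starts \<inter> {0..<L})"
    using finite_ends_interval[of 0 L] by (rule finite_subset[rotated]) (use starts_ends in auto)
qed (use starts_ends starts_shift mate_shift less_mate starts_noninclusion in auto)

lemma satisfies_allI:
  assumes "\<And>x. x \<in> starts \<Longrightarrow> pt ` {x<..<mate x} \<inter> S \<noteq> {}" and c: "c \<in> \<C>"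
  shows "satisfies (sphere z r) S c"
proof -
  have "pt ` {a<..<mate a} \<inter> S \<noteq> {}" if a: "a \<in> ends" for a
  proof -
    obtain x where x: "x \<in> starts" "a \<le> x" "mate x \<le> mate a" using arc_contains_empty[OF a] by blast
    hence "pt ` {x<..<mate x} \<subseteq> pt ` {a<..<mate a}" by (intro image_mono) auto
    thus ?thesis using assms(1)[OF x(1)] by blast
  qed
  moreover obtain a where "a \<in> ends" "c = chord_at a" using chord_obtain[OF c] .
  ultimately show ?thesis using mate_in_ends by (auto simp: satisfies_def arcs_of_chord_at)
qed

text \<open>The cliques colour the empty arcs, and the greedy corners result. The clique of the
  chord alone would not do as colour: a chord with two empty arcs would give the same colour to
  disjoint arcs.\<close>

lemma corners_of_clique_cover:
  assumes P: "partition_on (chord_at ` starts) P" "finite P" "2 \<le> card P"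
    and cl: "\<forall>K\<in>P. \<forall>c\<in>K. \<forall>d\<in>K. c \<noteq> d \<longrightarrow> chords_intersect c d"
  shows "\<exists>S. S \<subseteq> sphere z r - \<Union>\<C> \<and> finite S \<and> card S \<le> card P \<and> (\<forall>c\<in>\<C>. satisfies (sphere z r) S c)"
proof -
  have "\<not> card P \<le> Suc 0" using P by simp
  then obtain K0 K1 where K01: "K0 \<in> P" "K1 \<in> P" "K0 \<noteq> K1"
    using card_le_Suc0_iff_eq[OF P(2)] by blast
  have "K0 \<noteq> {}" "K0 \<subseteq> chord_at ` starts" using P(1) K01 by (auto simp: partition_on_def)
  then obtain x1 where "x1 \<in> starts" by auto
  hence "\<C> \<noteq> {}" using chord_at_in[OF starts_ends] by blast
  then interpret periodic_intervals L starts mate by (rule periodic_intervals_starts)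
  have "\<exists>K\<in>P. chord_at x \<in> K" if "x \<in> starts" for x
    using P(1) that by (auto simp: partition_on_def)
  then obtain cls where cls: "\<And>x. x \<in> starts \<Longrightarrow> cls x \<in> P" "\<And>x. x \<in> starts \<Longrightarrow> chord_at x \<in> cls x"
    by metis
  \<comment> \<open>An arbitrary endpoint of each chord, used to tell its two arcs apart
    consistently over all lifts.\<close>
  define rep where "rep c = (SOME p. p \<in> c)" for c :: chord
  have rep: "rep (chord_at x) = pt x \<or> rep (chord_at x) = pt (mate x)" for x
  proof -
    have "rep (chord_at x) \<in> chord_at x" unfolding rep_def by (rule someI[of _ "pt x"]) (simp add: chord_at_def)
    thus ?thesis by (auto simp: chord_at_def)
  qed
  \<comment> \<open>A chord with two empty arcs crosses all others, so its two arcs fit into any two cliques.\<close>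
  define q where "q x = (if mate x \<in> starts then if pt x = rep (chord_at x) then K0 else K1
    else cls x)" for x
  have "\<exists>x\<in>starts. x + L \<le> (greedy ^^ card P) x"
  proof (rule greedy_wraps[OF P(2) refl P(3)])
    show "q x \<in> P" if "x \<in> starts" for x using cls K01 that by (auto simp: q_def)
    fix x y assume xy: "x \<in> starts" "y \<in> starts" and qq: "q x = q y"
    have e: "x \<in> ends" "y \<in> ends" using xy starts_ends by auto
    have "meets x y"
    proof (cases "chord_at x = chord_at y")
      case True
      then consider k :: int where "y = x + of_int k * L" | k :: int where "y = mate x + of_int k * L"
        using chord_at_eq e by blast
      thus ?thesis
      proof cases
        case (1 k) thus ?thesis using meets_same[OF e(1), of k] by simp
      next
        \<comment> \<open>Here \<open>y\<close> names the opposite arc of the same chord. Both arcs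
          are empty, so the two starts receive \<open>K0\<close> and \<open>K1\<close>, contrary to
          \<open>qq\<close>.\<close>
        case (2 k)
        have "mate x = y + of_int (-k) * L" using 2 by simp
        hence mx: "mate x \<in> starts" using starts_shift[OF xy(2), of "-k"] by simp
        have "mate y = x + of_int (k + 1) * L"
          unfolding 2 mate_shift[OF mate_in_ends[OF e(1)]] mate_mate[OF e(1)]
          by (simp add: algebra_simps)
        hence my: "mate y \<in> starts" using starts_shift[OF xy(1), of "k + 1"] by simp
        have "pt y = pt (mate x)" using 2 by simp
        moreover have "pt x \<noteq> pt (mate x)"
          using pt_inj_period[of x "mate x"] less_mate[OF e(1)] mate_less[OF e(1)] by auto
        moreover have "q x = (if pt x = rep (chord_at x) then K0 else K1)"
            "q y = (if pt y = rep (chord_at x) then K0 else K1)"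
          using mx my True by (simp_all add: q_def)
        ultimately have "q x \<noteq> q y" using rep[of x] K01(3) by (cases "pt x = rep (chord_at x)") simp_all
        thus ?thesis using qq by contradiction
      qed
    next
      case False
      \<comment> \<open>A chord with two empty arcs overlaps all others whatever its colour; only in
        the last case does equal colour mean a common clique.\<close>
      consider "mate x \<in> starts" | "mate y \<in> starts" | "mate x \<notin> starts" "mate y \<notin> starts" by blast
      thus ?thesis
      proof cases
        case 1 thus ?thesis using double_start_meets[OF xy(1) _ e(2) False] by simp
      next
        case 2 thus ?thesis using double_start_meets[OF xy(2) _ e(1) False[symmetric]] meets_sym by simp
      next
        case 3
        hence "cls x = cls y" using qq by (simp add: q_def)
        hence "chord_at x \<in> cls x" "chord_at y \<in> cls x"
          using cls(2)[OF xy(1)] cls(2)[OF xy(2)] by simp_all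
        hence "chords_intersect (chord_at x) (chord_at y)" using cl cls(1)[OF xy(1)] False by simp
        thus ?thesis by (rule intersect_imp_meets[OF e False])
      qed
    qed
    thus "\<exists>k::int. x + of_int k * L < mate y \<and> y < mate x + of_int k * L" by (simp add: meets_def)
  qed
  then obtain x0 where x0: "x0 \<in> starts" "x0 + L \<le> (greedy ^^ card P) x0" by blast
  \<comment> \<open>Avoiding \<open>ends\<close> keeps the corners off the chord endpoints.\<close>
  obtain Q where Q: "finite Q" "card Q \<le> card P" "Q \<inter> ends = {}"
      "\<forall>y\<in>starts. \<exists>p\<in>Q. \<exists>k::int. y + of_int k * L < p \<and> p < mate y + of_int k * L"
    using greedy_hits[OF x0 finite_ends_interval] by blast
  have "satisfies (sphere z r) (pt ` Q) c" if c: "c \<in> \<C>" for c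
  proof (rule satisfies_allI[OF _ c])
    fix x assume "x \<in> starts"
    then obtain p k where p: "p \<in> Q" "x + of_int k * L < p" "p < mate x + of_int k * L" using Q(4) by blast
    have "pt (p + of_int (-k) * L) \<in> pt ` {x<..<mate x}" using p by (intro imageI) auto
    hence "pt p \<in> pt ` {x<..<mate x}" by (simp only: pt_shift)
    thus "pt ` {x<..<mate x} \<inter> pt ` Q \<noteq> {}" using p(1) by blast
  qed
  moreover have "pt ` Q \<subseteq> sphere z r - \<Union>\<C>" using Q(3) pt_in_sphere by (auto simp: ends_def)
  moreover have "card (pt ` Q) \<le> card P" using card_image_le[OF Q(1), of pt] Q(2) by linarith
  ultimately show ?thesis using Q(1) by blast
qed

text \<open>Each peripheral chord selects a corner in an empty arc of it. Chords with a common
  corner have overlapping empty arcs and hence cross, so grouping by corner yields cliques.\<close>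

lemma clique_cover_of_corners:
  assumes S: "finite S" and sat: "\<And>c. c \<in> \<C> \<Longrightarrow> satisfies (sphere z r) S c"
  shows "\<exists>P. partition_on (chord_at ` starts) P \<and> finite P \<and> card P \<le> card S \<and>
           (\<forall>K\<in>P. \<forall>c\<in>K. \<forall>d\<in>K. c \<noteq> d \<longrightarrow> chords_intersect c d)"
proof -
  define V where "V = chord_at ` starts"
  have "\<exists>x t. x \<in> starts \<and> chord_at x = c \<and> x < t \<and> t < mate x \<and> pt t \<in> S" if "c \<in> V" for c
  proof -
    obtain x where x: "x \<in> starts" "chord_at x = c" using \<open>c \<in> V\<close> by (auto simp: V_def)
    hence "satisfies (sphere z r) S (chord_at x)" using sat chord_at_in starts_ends by blast
    hence "pt ` {x<..<mate x} \<inter> S \<noteq> {}"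
      using x starts_ends by (auto simp: satisfies_def arcs_of_chord_at)
    thus ?thesis using x by auto
  qed
  then obtain x t where xt: "\<And>c. c \<in> V \<Longrightarrow> x c \<in> starts" "\<And>c. c \<in> V \<Longrightarrow> chord_at (x c) = c"
    "\<And>c. c \<in> V \<Longrightarrow> x c < t c" "\<And>c. c \<in> V \<Longrightarrow> t c < mate (x c)" "\<And>c. c \<in> V \<Longrightarrow> pt (t c) \<in> S"
    by metis
  define P where "P = (\<lambda>p. {c \<in> V. pt (t c) = p}) ` (\<lambda>c. pt (t c)) ` V"
  have sub: "(\<lambda>c. pt (t c)) ` V \<subseteq> S" using xt(5) by auto
  have fin: "finite ((\<lambda>c. pt (t c)) ` V)" using sub S finite_subset by blast
  have "card P \<le> card ((\<lambda>c. pt (t c)) ` V)" unfolding P_def by (rule card_image_le[OF fin])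
  also have "\<dots> \<le> card S" by (rule card_mono[OF S sub])
  finally have "card P \<le> card S" .
  moreover have "finite P" using fin by (simp add: P_def)
  moreover have "partition_on V P" by (rule partition_onI) (auto simp: P_def disjnt_def)
  moreover have "chords_intersect c d" if "K \<in> P" "c \<in> K" "d \<in> K" "c \<noteq> d" for K c d
  proof -
    have cd: "c \<in> V" "d \<in> V" "pt (t c) = pt (t d)" using that by (auto simp: P_def)
    then obtain k :: int where k: "t d = t c + of_int k * L" using pt_eq_iff by auto
    have "meets (x c) (x d)" unfolding meets_def
      using k xt(3,4)[OF cd(1)] xt(3,4)[OF cd(2)] by (intro exI[of _ k]) auto
    thus ?thesis using meets_imp_intersect[of "x c" "x d"] xt cd that by auto
  qed
  ultimately show ?thesis unfolding V_def by blast
qed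

lemma polygon_number_eq:
  assumes c: "c \<in> \<C>" and d: "d \<in> \<C>" and ne: "c \<noteq> d" and ni: "\<not> chords_intersect c d"
  shows "polygon_number (sphere z r) \<C> =
    clique_cover_number (intersection_graph (peripheral_chords (sphere z r) \<C>))"
proof -
  define V where "V = chord_at ` starts"
  \<comment> \<open>With these predicates both parameters are least cardinalities, and it remains to
    convert each kind of object into one of the other kind that is no larger.\<close>
  define cover where "cover P \<longleftrightarrow> partition_on V P \<and> finite P \<and>
    (\<forall>K\<in>P. \<forall>c\<in>K. \<forall>d\<in>K. c \<noteq> d \<longrightarrow> chords_intersect c d)" for P
  define corners where "corners S \<longleftrightarrow> S \<subseteq> sphere z r - \<Union>\<C> \<and> finite S \<and>
    (\<forall>c\<in>\<C>. satisfies (sphere z r) S c)" for S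
  have poly: "polygon_number (sphere z r) \<C> = (LEAST k. \<exists>S. corners S \<and> card S = k)"
    unfolding polygon_number_def corners_def by (simp only: conj_ac)
  have cl: "clique (intersection_graph V) K \<longleftrightarrow>
      K \<subseteq> V \<and> (\<forall>c\<in>K. \<forall>d\<in>K. c \<noteq> d \<longrightarrow> chords_intersect c d)" for K
    by (auto simp: clique_def intersection_graph_def)
  have "(\<forall>K\<in>P. clique (intersection_graph V) K) \<longleftrightarrow>
      (\<forall>K\<in>P. \<forall>c\<in>K. \<forall>d\<in>K. c \<noteq> d \<longrightarrow> chords_intersect c d)" if "partition_on V P" for P
  proof (rule ball_cong[OF refl])
    fix K assume "K \<in> P"
    hence "K \<subseteq> V" using that by (auto simp: partition_on_def)
    thus "clique (intersection_graph V) K \<longleftrightarrow>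
        (\<forall>c\<in>K. \<forall>d\<in>K. c \<noteq> d \<longrightarrow> chords_intersect c d)" by (simp only: cl simp_thms)
  qed
  hence "partition_on V P \<and> finite P \<and> card P = k \<and> (\<forall>K\<in>P. clique (intersection_graph V) K)
      \<longleftrightarrow> cover P \<and> card P = k" for P k
    unfolding cover_def by (cases "partition_on V P") (simp_all only: simp_thms conj_ac)
  hence cover: "clique_cover_number (intersection_graph (peripheral_chords (sphere z r) \<C>)) =
      (LEAST k. \<exists>P. cover P \<and> card P = k)"
    unfolding clique_cover_number_def peripheral_eq V_def[symmetric]
    by (simp add: intersection_graph_def)
  have two: "2 \<le> card P" if P: "cover P" for P
  proof (rule ccontr)
    assume "\<not> ?thesis"
    hence eq: "K = K'" if "K \<in> P" "K' \<in> P" for K K'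
      using card_le_Suc0_iff_eq[of P] P that by (auto simp: cover_def)
    obtain x y where xy: "x \<in> starts" "y \<in> starts" "chord_at x \<noteq> chord_at y"
        "\<not> chords_intersect (chord_at x) (chord_at y)"
      using parallel_peripheral[OF c d ne ni] by blast
    have "\<Union>P = V" using P by (auto simp: cover_def partition_on_def)
    hence "chord_at x \<in> \<Union>P" "chord_at y \<in> \<Union>P" using xy by (auto simp: V_def)
    then obtain K where "K \<in> P" "chord_at x \<in> K" "chord_at y \<in> K" using eq by blast
    thus False using xy(3,4) P unfolding cover_def by simp
  qed
  have fwd: "\<exists>S. corners S \<and> card S \<le> card P" if P: "cover P" for P
  proof -
    have P': "partition_on (chord_at ` starts) P" "finite P"
        "\<forall>K\<in>P. \<forall>c\<in>K. \<forall>d\<in>K. c \<noteq> d \<longrightarrow> chords_intersect c d"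
      using P unfolding cover_def V_def by simp_all
    show ?thesis using corners_of_clique_cover[OF P'(1,2) two[OF P] P'(3)]
      unfolding corners_def by (simp only: conj_ac)
  qed
  have bwd: "\<exists>P. cover P \<and> card P \<le> card S" if S: "corners S" for S
  proof -
    have "finite S" "\<And>c. c \<in> \<C> \<Longrightarrow> satisfies (sphere z r) S c"
      using S unfolding corners_def by simp_all
    from clique_cover_of_corners[OF this] show ?thesis
      unfolding cover_def V_def by (simp only: conj_ac)
  qed
  have "finite V"
    using finite_subset[OF _ finite_chords, of V] chord_at_in starts_ends by (auto simp: V_def)
  \<comment> \<open>The singletons form a cover, and \<open>fwd\<close> turns it into a set of
    corners, so both minima are attained.\<close>
  hence singletons: "cover ((\<lambda>c. {c}) ` V)"
    unfolding cover_def by (auto simp: disjnt_def intro!: partition_onI)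
  then obtain S0 where S0: "corners S0" using fwd by blast
  show ?thesis
  proof (rule antisym)
    have "\<exists>P. cover P \<and> card P = (LEAST k. \<exists>P. cover P \<and> card P = k)"
      by (rule LeastI_ex) (use singletons in blast)
    then obtain P where P: "cover P" "card P = (LEAST k. \<exists>P. cover P \<and> card P = k)" by blast
    obtain S where "corners S" "card S \<le> card P" using fwd[OF P(1)] by blast
    thus "polygon_number (sphere z r) \<C> \<le>
        clique_cover_number (intersection_graph (peripheral_chords (sphere z r) \<C>))"
      unfolding poly cover P(2)[symmetric] by (intro order_trans[OF Least_le]) auto
    have "\<exists>S. corners S \<and> card S = (LEAST k. \<exists>S. corners S \<and> card S = k)"
      by (rule LeastI_ex) (use S0 in blast)
    then obtain S where S: "corners S" "card S = (LEAST k. \<exists>S. corners S \<and> card S = k)" by blast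
    obtain P where "cover P" "card P \<le> card S" using bwd[OF S(1)] by blast
    thus "clique_cover_number (intersection_graph (peripheral_chords (sphere z r) \<C>)) \<le>
        polygon_number (sphere z r) \<C>"
      unfolding poly cover S(2)[symmetric] by (intro order_trans[OF Least_le]) auto
  qed
qed

end

theorem theorem2:
  fixes G :: "'a pair_pre_digraph" and \<Gamma> :: "complex set" and \<C> :: "chord set"
  assumes "pair_graph G"
    and "\<not> clique G (pverts G)"
    and "circle_representation \<Gamma> \<C> G"
  shows "polygon_number \<Gamma> \<C> = clique_cover_number (intersection_graph (peripheral_chords \<Gamma> \<C>))"
proof -
  interpret pair_graph G by (rule assms(1))
  obtain z r where zr: "r > 0" "\<Gamma> = sphere z r"
    using assms(3) by (auto simp: circle_representation_def is_circle_def)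
  obtain f where f: "bij_betw f (pverts G) \<C>"
      "\<And>u v. u \<in> pverts G \<Longrightarrow> v \<in> pverts G \<Longrightarrow> u \<noteq> v \<Longrightarrow>
         (u, v) \<in> parcs G \<longleftrightarrow> chords_intersect (f u) (f v)"
    using assms(3) unfolding circle_representation_def by blast
  interpret chord_diagram z r \<C>
  proof
    show "finite \<C>" using f(1) pair_finite_verts bij_betw_finite by blast
  qed (use assms(3) zr in \<open>auto simp: circle_representation_def\<close>)
  \<comment> \<open>Failing to be a clique provides the pair of non-crossing chords that
    \<open>polygon_number_eq\<close> requires.\<close>
  obtain u v where uv: "u \<in> pverts G" "v \<in> pverts G" "u \<noteq> v" "(u, v) \<notin> parcs G"
    using assms(2) by (auto simp: clique_def)
  have "f u \<noteq> f v" "f u \<in> \<C>" "f v \<in> \<C>"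
    using f(1) uv by (auto simp: bij_betw_def dest: inj_onD)
  thus ?thesis unfolding zr using polygon_number_eq f(2)[OF uv(1-3)] uv(4) by blast
qed

end
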